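(* Let $d\in\mathbb{N}$, $d\ge 2$, and let $\alpha,\beta,\gamma\in\mathbb{R}$ satisfy $\alpha>\gamma-\beta\ge 0$ and $\alpha+\beta>0$. Then for all $M\in\mathbb{N}$ $$g^{\mathrm{latt}_1}_M(\mathcal{H}^{\alpha,\beta}(\mathbb{T}^d)\cap^* C(\mathbb{T}^d),\mathcal{H}^{\gamma}(\mathbb{T}^d))\ \ge\ 2^{-(\alpha+\beta-\gamma+1)/2}\,M^{-(\alpha+\beta-\gamma)/2}$$ and $$g^{\mathrm{latt}_1}_M(\mathcal{H}^{\alpha,\beta}(\mathbb{T}^d)\cap^* C(\mathbb{T}^d),\mathcal{H}^{\gamma}_{\mathrm{mix}}(\mathbb{T}^d))\ \ge\ 2^{-(\alpha+\beta-\gamma+1)/2}\,M^{-(\alpha+\beta-\gamma)/2}.$$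
   Context: $\mathbb{T}=[0,1)$ is the torus, $\hat f_{\boldsymbol k}=\int_{\mathbb{T}^d}f(\boldsymbol x)e^{-2\pi i\boldsymbol k\cdot\boldsymbol x}\,d\boldsymbol x$. For real $\alpha,\beta$, $\mathcal{H}^{\alpha,\beta}(\mathbb{T}^d)$ is the space of $f\in L_2(\mathbb{T}^d)$ with finite norm $$\|f|\mathcal{H}^{\alpha,\beta}(\mathbb{T}^d)\|^2=\sum_{\boldsymbol k\in\mathbb{Z}^d}|\hat f_{\boldsymbol k}|^2(1+\|\boldsymbol k\|_2^2)^{\beta}\prod_{s=1}^d(1+|k_s|^2)^{\alpha}.$$ Put $\mathcal{H}^{\gamma}(\mathbb{T}^d):=\mathcal{H}^{0,\gamma}(\mathbb{T}^d)$ and $\mathcal{H}^{\gamma}_{\mathrm{mix}}(\mathbb{T}^d):=\mathcal{H}^{\gamma,0}(\mathbb{T}^d)$. The space $\mathcal{H}^{\alpha,\beta}(\mathbb{T}^d)\cap^* C(\mathbb{T}^d):=\{f\in C(\mathbb{T}^d):\|f|\mathcal{H}^{\alpha,\beta}(\mathbb{T}^d)\|<\infty\}$ is equipped with the norm of $\mathcal{H}^{\alpha,\beta}(\mathbb{T}^d)$. For $\boldsymbol z\in\mathbb{Z}^d$, $M\in\mathbb{N}$, the rank-1 lattice $\Lambda(\boldsymbol z,M)$ consists of the points $\boldsymbol x_j=\frac{j}{M}\boldsymbol z\bmod\boldsymbol 1$, $j=0,\dots,M-1$. Define $$\operatorname{Samp}_{\Lambda(\boldsymbol z,M)}(\mathcal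 F,Y):=\inf_{A:\mathbb{C}^M\to Y}\ \sup_{\|f|\mathcal F\|\le1}\big\|f-A\big((f(\boldsymbol x_j))_{j=0}^{M-1}\big)\big\|_Y,$$ where $A$ ranges over all (possibly non-linear) maps (with $\|\cdot\|_Y=+\infty$ outside $Y$), and $$g_M^{\mathrm{latt}_1}(\mathcal F,Y):=\inf_{\boldsymbol z\in\mathbb{Z}^d}\operatorname{Samp}_{\Lambda(\boldsymbol z,M)}(\mathcal F,Y).$$ *)

theory Defs
  imports "HOL-Analysis.Analysis"
begin

(* Dimension d = CARD('d).  Functions on the torus are represented by functions on R^d that are
   1-periodic in every coordinate; all integrals are taken over the unit cube [0,1)^d. *)

definition of_int_vec :: "int ^ 'd \<Rightarrow> real ^ 'd" where
  "of_int_vec k = (\<chi> i. real_of_int (k $ i))"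

definition periodic1 :: "(real ^ 'd \<Rightarrow> complex) \<Rightarrow> bool" where
  "periodic1 f \<longleftrightarrow> (\<forall>x k. f (x + of_int_vec k) = f x)"

definition unit_cube :: "(real ^ 'd) set" where
  "unit_cube = {x. \<forall>i. 0 \<le> x $ i \<and> x $ i < 1}"

(* Elements are representatives; functions that agree almost everywhere are not identified. *)
definition L2_torus :: "(real ^ 'd::finite \<Rightarrow> complex) set" where
  "L2_torus = {f. periodic1 f \<and> f \<in> borel_measurable lebesgue \<and>
                  set_integrable lebesgue unit_cube (\<lambda>x. (cmod (f x))\<^sup>2)}"

definition C_torus :: "(real ^ 'd::finite \<Rightarrow> complex) set" where
  "C_torus = {f. periodic1 f \<and> continuous_on UNIV f}"

definition fourier_coeff :: "(real ^ 'd::finite \<Rightarrow> complex) \<Rightarrow> int ^ 'd \<Rightarrow> complex" where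
  "fourier_coeff f k =
     (LINT x:unit_cube|lebesgue. f x * exp (- 2 * of_real pi * \<i> * of_real (of_int_vec k \<bullet> x)))"

definition hybrid_weight :: "real \<Rightarrow> real \<Rightarrow> int ^ 'd::finite \<Rightarrow> real" where
  "hybrid_weight \<alpha> \<beta> k =
     (1 + (norm (of_int_vec k))\<^sup>2) powr \<beta> * (\<Prod>s\<in>UNIV. (1 + \<bar>real_of_int (k $ s)\<bar>\<^sup>2) powr \<alpha>)"

(* The norm is extended by infinity to all functions outside the space. *)
definition hybrid_norm :: "real \<Rightarrow> real \<Rightarrow> (real ^ 'd::finite \<Rightarrow> complex) \<Rightarrow> ennreal" where
  "hybrid_norm \<alpha> \<beta> f =
     (if f \<in> L2_torus \<and> (\<lambda>k. (cmod (fourier_coeff f k))\<^sup>2 * hybrid_weight \<alpha> \<beta> k) summable_on UNIV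
      then ennreal (sqrt (\<Sum>\<^sub>\<infinity>k. (cmod (fourier_coeff f k))\<^sup>2 * hybrid_weight \<alpha> \<beta> k))
      else \<infinity>)"

(* A function space is given by its carrier and its norm, the latter being infinite where undefined. *)
type_synonym 'd fspace = "(real ^ 'd \<Rightarrow> complex) set \<times> ((real ^ 'd \<Rightarrow> complex) \<Rightarrow> ennreal)"

definition H_hybrid :: "real \<Rightarrow> real \<Rightarrow> 'd::finite fspace" where
  "H_hybrid \<alpha> \<beta> = ({f \<in> L2_torus. hybrid_norm \<alpha> \<beta> f < \<infinity>}, hybrid_norm \<alpha> \<beta>)"

definition H_iso :: "real \<Rightarrow> 'd::finite fspace" where
  "H_iso \<gamma> = H_hybrid 0 \<gamma>"

definition H_mix :: "real \<Rightarrow> 'd::finite fspace" where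
  "H_mix \<gamma> = H_hybrid \<gamma> 0"

definition cap_C :: "'d::finite fspace \<Rightarrow> 'd fspace" where
  "cap_C F = ({f \<in> C_torus. snd F f < \<infinity>}, snd F)"

definition lattice_point :: "int ^ 'd \<Rightarrow> nat \<Rightarrow> nat \<Rightarrow> real ^ 'd" where
  "lattice_point z M j = (\<chi> i. frac (real j / real M * real_of_int (z $ i)))"

(* The elements of C^M are the extensional functions {..<M} \<rightarrow>\<^sub>E UNIV. *)
definition lattice_samples :: "int ^ 'd \<Rightarrow> nat \<Rightarrow> (real ^ 'd \<Rightarrow> complex) \<Rightarrow> nat \<Rightarrow> complex" where
  "lattice_samples z M f = (\<lambda>j\<in>{..<M}. f (lattice_point z M j))"

definition Samp :: "int ^ 'd \<Rightarrow> nat \<Rightarrow> 'd::finite fspace \<Rightarrow> 'd fspace \<Rightarrow> ennreal" where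
  "Samp z M F Y =
     (INF A \<in> ({..<M} \<rightarrow>\<^sub>E (UNIV :: complex set)) \<rightarrow> fst Y.
        SUP f \<in> {f \<in> fst F. snd F f \<le> 1}. snd Y (\<lambda>x. f x - A (lattice_samples z M f) x))"

definition g_latt :: "nat \<Rightarrow> 'd::finite fspace \<Rightarrow> 'd fspace \<Rightarrow> ennreal" where
  "g_latt M F Y = (INF z. Samp z M F Y)"

end

theory Submission
  imports Defs
begin

text \<open>
  Two characters with frequencies \<open>h\<close> and \<open>k\<close> agree on the lattice as soon as
  \<open>h \<bullet> z \<equiv> k \<bullet> z (mod M)\<close>.  By Thue's pigeonhole argument such frequencies exist on two
  different coordinate axes with entries at most \<open>\<surd>M\<close> in absolute value.  The normalised
  difference \<open>f\<close> of the two characters vanishes at all sampling points, so no algorithm can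
  distinguish \<open>f\<close> from \<open>- f\<close>, and the parallelogram law bounds the worst-case error from below by
  the target norm of \<open>f\<close>.  For a frequency on an axis with entry \<open>n\<close> the weights of all
  spaces involved are powers of \<open>1 + n\<^sup>2 \<le> 2 M\<close> that only depend on the sum of the two smoothness
  parameters.
\<close>

section \<open>Characters of the torus and aliasing on the lattice\<close>

definition torus_char :: "int ^ 'd \<Rightarrow> real ^ 'd::finite \<Rightarrow> complex" where
  "torus_char k x = cis (2 * pi * (of_int_vec k \<bullet> x))"

lemma of_int_vec_inner_of_int_vec:
  "of_int_vec k \<bullet> of_int_vec l = real_of_int (\<Sum>i\<in>UNIV. k $ i * l $ i)"
  by (simp add: of_int_vec_def inner_vec_def)

lemma of_int_vec_diff: "of_int_vec (k - l) = of_int_vec k - of_int_vec l"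
  by (simp add: of_int_vec_def vec_eq_iff)

lemma cis_2pi_of_int: "cis (2 * pi * real_of_int n) = 1"
  by (simp add: cis_multiple_2pi)

lemma periodic1_torus_char: "periodic1 (torus_char k)"
  by (simp add: periodic1_def torus_char_def inner_add_right distrib_left of_int_vec_inner_of_int_vec
      cis_mult [symmetric] cis_2pi_of_int del: of_int_sum)

lemma norm_torus_char [simp]: "cmod (torus_char k x) = 1"
  by (simp add: torus_char_def)

lemma continuous_on_torus_char: "continuous_on S (torus_char k)"
  unfolding torus_char_def cis_conv_exp by (intro continuous_intros)

text \<open>Turns every Fourier coefficient of a character into the integral of a single
  character.\<close>

lemma torus_char_mult_exp:
  "torus_char h x * exp (- 2 * of_real pi * \<i> * of_real (of_int_vec k \<bullet> x)) = torus_char (h - k) x"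
  by (simp add: torus_char_def cis_conv_exp of_int_vec_diff inner_diff_left algebra_simps
      flip: exp_add)

text \<open>A lattice point is (j/M) z minus an integer vector. Since (h - k) \<bullet> z is a
  multiple of M, the phase of the quotient character \<open>torus_char (h - k)\<close> there is an
  integer, so the quotient is 1.\<close>

lemma torus_char_eq_at_lattice_point:
  assumes "M \<ge> 1"
    and "int M dvd (\<Sum>i\<in>UNIV. h $ i * z $ i) - (\<Sum>i\<in>UNIV. k $ i * z $ i)"
  shows "torus_char h (lattice_point z M j) = torus_char k (lattice_point z M j)"
proof -
  define y where "y = lattice_point z M j"
  obtain q where q: "(\<Sum>i\<in>UNIV. h $ i * z $ i) - (\<Sum>i\<in>UNIV. k $ i * z $ i) = int M * q"
    using assms(2) by (auto simp: dvd_def)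
  define v :: "int ^ 'a" where "v = (\<chi> i. \<lfloor>real j / real M * real_of_int (z $ i)\<rfloor>)"
  have y: "y = (real j / real M) *\<^sub>R of_int_vec z - of_int_vec v"
    by (simp add: y_def lattice_point_def vec_eq_iff v_def of_int_vec_def frac_def)
  have "(of_int_vec h - of_int_vec k) \<bullet> of_int_vec z = real M * real_of_int q"
    using arg_cong [OF q, of real_of_int]
    by (simp add: inner_diff_left of_int_vec_inner_of_int_vec)
  then have "of_int_vec (h - k) \<bullet> y
      = real_of_int (int j * q - (\<Sum>i\<in>UNIV. (h - k) $ i * v $ i))"
    using assms(1)
    by (simp add: y inner_diff_right of_int_vec_inner_of_int_vec flip: of_int_vec_diff)
  then have "torus_char (h - k) y = 1"
    unfolding torus_char_def by (simp only: cis_2pi_of_int)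
  moreover have "torus_char h y = torus_char k y * torus_char (h - k) y"
    by (simp add: torus_char_def of_int_vec_diff inner_diff_left cis_mult flip: distrib_left)
  ultimately show ?thesis
    by (simp add: y_def)
qed

section \<open>Integrability on the unit cube and linearity of Fourier coefficients\<close>

lemma unit_cube_eq: "unit_cube = {x. \<forall>b\<in>Basis. 0 \<le> x \<bullet> b \<and> x \<bullet> b < 1}"
  by (auto simp: unit_cube_def Basis_vec_def inner_axis)

lemma unit_cube_borel [measurable]: "unit_cube \<in> sets (borel :: (real ^ 'd::finite) measure)"
proof -
  have "unit_cube = (\<Inter>i. {x :: real ^ 'd. 0 \<le> x $ i} \<inter> {x. x $ i < 1})"
    by (auto simp: unit_cube_def)
  also have "\<dots> \<in> sets borel"
    by (intro sets.finite_INT sets.Int) auto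
  finally show ?thesis .
qed

lemma unit_cube_lebesgue [measurable]: "unit_cube \<in> sets lebesgue"
  using unit_cube_borel by (rule sets_completionI_sets [of _ lborel, simplified])

lemma unit_cube_subset: "unit_cube \<subseteq> cbox (0 :: real ^ 'd::finite) 1"
  by (auto simp: unit_cube_def mem_box_cart less_imp_le)

lemma set_integrable_unit_cube:
  fixes f :: "real ^ 'd::finite \<Rightarrow> 'b::euclidean_space"
  assumes "continuous_on UNIV f"
  shows "set_integrable lebesgue unit_cube f"
  by (rule set_integrable_subset [OF absolutely_integrable_continuous unit_cube_lebesgue unit_cube_subset])
    (use assms continuous_on_subset in blast)

lemma C_torus_subset_L2_torus: "C_torus \<subseteq> L2_torus"
proof
  fix f :: "real ^ 'a \<Rightarrow> complex" assume f: "f \<in> C_torus"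
  then have "f \<in> borel_measurable lebesgue"
    by (intro measurable_completion) (auto simp: C_torus_def intro: borel_measurable_continuous_onI)
  then show "f \<in> L2_torus"
    using f by (auto simp: C_torus_def L2_torus_def intro!: set_integrable_unit_cube continuous_intros)
qed

text \<open>The cube has finite measure, so 1 + |f|^2 is an integrable majorant of |f|.
  Integrability is what makes Fourier coefficients additive.\<close>

lemma set_integrable_fourier:
  assumes "f \<in> L2_torus"
  shows "set_integrable lebesgue unit_cube
    (\<lambda>x. f x * exp (- 2 * of_real pi * \<i> * of_real (of_int_vec k \<bullet> x)))"
proof (rule set_integrable_bound [where f = "\<lambda>x. 1 + (cmod (f x))\<^sup>2"])
  show "set_integrable lebesgue unit_cube (\<lambda>x. 1 + (cmod (f x))\<^sup>2)"
    using assms by (intro set_integral_add(1) set_integrable_unit_cube [of "\<lambda>_. 1"]) (auto simp: L2_torus_def)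
  have [measurable]: "f \<in> borel_measurable lebesgue"
    using assms by (simp add: L2_torus_def)
  have [measurable]: "(\<lambda>x. exp (- 2 * of_real pi * \<i> * of_real (of_int_vec k \<bullet> x))) \<in> borel_measurable lebesgue"
    by (intro measurable_completion) (simp; intro borel_measurable_continuous_onI continuous_intros)
  show "set_borel_measurable lebesgue unit_cube
      (\<lambda>x. f x * exp (- 2 * of_real pi * \<i> * of_real (of_int_vec k \<bullet> x)))"
    unfolding set_borel_measurable_def by measurable
  have "t \<le> 1 + t\<^sup>2" if "t \<ge> 0" for t :: real
    using zero_le_power2 [of "t - 1"] that by (simp add: power2_diff)
  then show "AE x in lebesgue. x \<in> unit_cube \<longrightarrow>
      norm (f x * exp (- 2 * of_real pi * \<i> * of_real (of_int_vec k \<bullet> x))) \<le> norm (1 + (cmod (f x))\<^sup>2)"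
    by (auto simp: norm_mult)
qed

lemma fourier_coeff_diff:
  assumes "f \<in> L2_torus" "g \<in> L2_torus"
  shows "fourier_coeff (\<lambda>x. f x - g x) k = fourier_coeff f k - fourier_coeff g k"
  using set_integral_diff(2) [OF assms [THEN set_integrable_fourier]]
  by (simp add: fourier_coeff_def algebra_simps)

lemma fourier_coeff_cmult: "fourier_coeff (\<lambda>x. c * f x) k = c * fourier_coeff f k"
  by (simp add: fourier_coeff_def mult.assoc)

section \<open>Orthogonality of the characters\<close>

text \<open>Fubini for a product of functions of one coordinate each: \<open>lborel\<close> is the
  image of the product measure indexed by \<open>Basis\<close>.\<close>

lemma integral_lborel_prod:
  fixes f :: "'a::euclidean_space \<Rightarrow> real \<Rightarrow> 'b::{real_normed_field, banach, second_countable_topology}"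
  assumes "\<And>b. b \<in> Basis \<Longrightarrow> integrable lborel (f b)"
  shows "(LINT x|lborel. (\<Prod>b\<in>Basis. f b (x \<bullet> b))) = (\<Prod>b\<in>Basis. LINT t|lborel. f b t)"
proof -
  interpret product_sigma_finite "\<lambda>_::'a. lborel :: real measure" ..
  have [measurable]: "\<And>b. b \<in> Basis \<Longrightarrow> f b \<in> borel_measurable borel"
    using borel_measurable_integrable [OF assms] by simp
  have "(LINT x|lborel. (\<Prod>b\<in>Basis. f b (x \<bullet> b)))
      = (LINT y|(\<Pi>\<^sub>M b\<in>Basis. lborel). (\<Prod>b\<in>Basis. f b ((\<Sum>b\<in>Basis. y b *\<^sub>R b) \<bullet> b)))"
    by (subst lborel_eq, subst integral_distr) simp_all
  also have "\<dots> = (LINT y|(\<Pi>\<^sub>M b\<in>Basis. lborel). (\<Prod>b\<in>Basis. f b (y b)))"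
    by (simp cong: prod.cong)
  also have "\<dots> = (\<Prod>b\<in>Basis. LINT t|lborel. f b t)"
    using assms by (intro product_integral_prod) auto
  finally show ?thesis .
qed

lemma set_integrable_cis: "set_integrable lborel {0..<1} (\<lambda>t::real. cis (a * t))"
  by (rule set_integrable_subset [where A = "{0..1}"])
    (auto simp: cis_conv_exp intro!: borel_integrable_atLeastAtMost' continuous_intros)

text \<open>For nonzero n the antiderivative \<open>cis (?a * t) / (\<i> * ?a)\<close> takes equal
  values at 0 and 1.\<close>

lemma integral_cis_period:
  "(LINT t:{0..<1}|lborel. cis (2 * pi * real_of_int n * t)) = (if n = 0 then 1 else 0)"
proof (cases "n = 0")
  case True
  then show ?thesis by (simp add: set_lebesgue_integral_def)
next
  case False
  let ?a = "2 * pi * real_of_int n"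
  have "((\<lambda>t. cis (?a * t)) has_integral cis (?a * 1) / (\<i> * ?a) - cis (?a * 0) / (\<i> * ?a)) {0..1}"
  proof (rule fundamental_theorem_of_calculus)
    fix t :: real
    have "((\<lambda>w. exp (\<i> * ?a * w) / (\<i> * ?a)) has_field_derivative exp (\<i> * ?a * t)) (at (of_real t))"
      using False by (auto intro!: derivative_eq_intros)
    then show "((\<lambda>t. cis (?a * t) / (\<i> * ?a)) has_vector_derivative cis (?a * t)) (at t within {0..1})"
      using has_vector_derivative_real_field by (fastforce simp: cis_conv_exp mult.assoc)
  qed simp
  then have "((\<lambda>t. cis (?a * t)) has_integral 0) {0..1}"
    by (simp add: cis_2pi_of_int)
  \<comment> \<open>Dropping the endpoint 1 changes the domain by a null set only.\<close>
  then have "((\<lambda>t. cis (?a * t)) has_integral 0) {0..<1}"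
    by (rule has_integral_spike_set_eq [THEN iffD1, rotated -1])
      (auto intro: negligible_subset [of "{1}"])
  then have "integral {0..<1} (\<lambda>t. cis (?a * t)) = 0"
    by (rule integral_unique)
  then show ?thesis
    using False by (simp add: set_borel_integral_eq_integral(2) set_integrable_cis)
qed

lemma integral_torus_char:
  "(LINT x:unit_cube|lebesgue. torus_char m x) = (if m = 0 then 1 else 0)"
proof -
  \<comment> \<open>Each factor carries its own indicator, so that the integrand over the cube
    becomes a product over the whole space, as Fubini requires.\<close>
  let ?F = "\<lambda>b t. indicator {0..<1} t *\<^sub>R cis (2 * pi * (of_int_vec m \<bullet> b) * t)"
  have integrable: "integrable lborel (?F b)" for b
    using set_integrable_cis by (simp add: set_integrable_def)
  have factor: "(indicator unit_cube x *\<^sub>R torus_char m x :: complex) = (\<Prod>b\<in>Basis. ?F b (x \<bullet> b))" for x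
  proof (cases "x \<in> unit_cube")
    case True
    have "torus_char m x = cis (\<Sum>b\<in>Basis. 2 * pi * (of_int_vec m \<bullet> b) * (x \<bullet> b))"
      unfolding torus_char_def by (subst euclidean_inner) (simp add: sum_distrib_left mult.assoc)
    also have "\<dots> = (\<Prod>b\<in>Basis. cis (2 * pi * (of_int_vec m \<bullet> b) * (x \<bullet> b)))"
      by (simp add: cis_conv_exp sum_distrib_left flip: exp_sum)
    also have "\<dots> = (\<Prod>b\<in>Basis. ?F b (x \<bullet> b))"
      using True by (intro prod.cong) (auto simp: unit_cube_eq)
    finally show ?thesis using True by simp
  next
    case False
    then obtain b where "b \<in> Basis" "x \<bullet> b \<notin> {0..<1}"
      by (auto simp: unit_cube_eq)
    then have "(\<Prod>b\<in>Basis. ?F b (x \<bullet> b)) = 0"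
      by (intro prod_zero) (auto intro!: bexI [of _ b])
    then show ?thesis using False by simp
  qed
  have "(LINT x:unit_cube|lebesgue. torus_char m x) = (LINT x:unit_cube|lborel. torus_char m x)"
    unfolding set_lebesgue_integral_def
    by (intro integral_completion)
      (auto intro!: borel_measurable_scaleR borel_measurable_continuous_onI [OF continuous_on_torus_char])
  also have "\<dots> = (\<Prod>b\<in>Basis. LINT t|lborel. ?F b t)"
    unfolding set_lebesgue_integral_def factor using integrable by (intro integral_lborel_prod) auto
  also have "\<dots> = (\<Prod>i\<in>UNIV. LINT t:{0..<1}|lborel. cis (2 * pi * real_of_int (m $ i) * t))"
    by (simp add: set_lebesgue_integral_def Basis_vec_def UNION_singleton_eq_range prod.reindex
        inj_on_def axis_eq_axis inner_axis of_int_vec_def)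
  also have "\<dots> = (if m = 0 then 1 else 0)"
    by (auto simp: integral_cis_period vec_eq_iff)
  finally show ?thesis .
qed

lemma fourier_coeff_torus_char: "fourier_coeff (torus_char h) k = (if k = h then 1 else 0)"
  unfolding fourier_coeff_def torus_char_mult_exp integral_torus_char by simp

section \<open>Weights and norms\<close>

lemma hybrid_weight_pos: "hybrid_weight \<alpha> \<beta> k > 0"
  unfolding hybrid_weight_def
  by (intro mult_pos_pos prod_pos ballI powr_gt_zero [THEN iffD2])
    (simp_all add: add_pos_nonneg less_imp_neq [symmetric])

text \<open>Only the factor at s can differ from 1, and its base equals that of the isotropic
  weight. Isotropic and mixed smoothness are therefore indistinguishable on the axes, which lets one
  argument serve both target spaces.\<close>

lemma hybrid_weight_axis:
  "hybrid_weight \<alpha> \<beta> (axis s n :: int ^ 'd::finite) = (1 + (real_of_int n)\<^sup>2) powr (\<alpha> + \<beta>)"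
proof -
  have axis: "of_int_vec (axis s n :: int ^ 'd) = axis s (real_of_int n)"
    by (simp add: of_int_vec_def axis_def vec_eq_iff)
  have "(\<Prod>i\<in>UNIV. (1 + \<bar>real_of_int ((axis s n :: int ^ 'd) $ i)\<bar>\<^sup>2) powr \<alpha>)
      = (\<Prod>i\<in>{s}. (1 + \<bar>real_of_int ((axis s n :: int ^ 'd) $ i)\<bar>\<^sup>2) powr \<alpha>)"
    by (intro prod.mono_neutral_right) (auto simp: axis_def)
  then show ?thesis
    by (simp add: hybrid_weight_def axis norm_axis_1 norm_eq_sqrt_inner inner_axis_axis powr_add
        flip: power2_eq_square)
qed

lemma fourier_coeff_uminus: "fourier_coeff (\<lambda>x. - f x) k = - fourier_coeff f k"
  using fourier_coeff_cmult [of "-1" f k] by simp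

lemma uminus_in_C_torus: "f \<in> C_torus \<Longrightarrow> (\<lambda>x. - f x) \<in> C_torus"
  by (auto simp: C_torus_def periodic1_def intro: continuous_on_minus)

lemma hybrid_norm_uminus:
  assumes "f \<in> C_torus"
  shows "hybrid_norm \<alpha> \<beta> (\<lambda>x. - f x) = hybrid_norm \<alpha> \<beta> f"
  using assms uminus_in_C_torus [OF assms] C_torus_subset_L2_torus
  by (auto simp: hybrid_norm_def fourier_coeff_uminus)

text \<open>Partial sums of a nonnegative series are below its value, and the claim is trivial where
  the norm is infinite. Lower bounds thus never require summability for the error functions.\<close>

lemma sum_le_hybrid_norm:
  assumes "finite S"
  shows "ennreal (sqrt (\<Sum>k\<in>S. (cmod (fourier_coeff f k))\<^sup>2 * hybrid_weight \<alpha> \<beta> k)) \<le> hybrid_norm \<alpha> \<beta> f"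
  unfolding hybrid_norm_def
  using assms by (auto intro!: ennreal_leI finite_sum_le_infsum simp: hybrid_weight_pos less_imp_le)

section \<open>Lower bound from a function vanishing on the lattice\<close>

text \<open>The parallelogram law for the coefficients, summed against the weights over S, bounds
  the mean of the two squared errors from below by \<open>Q f + Q g\<close>; hence one of them is at
  least \<open>Q f\<close>.\<close>

lemma sum_le_max_hybrid_norm:
  assumes "f \<in> L2_torus" "(\<lambda>x. - f x) \<in> L2_torus" "g \<in> L2_torus" "finite S"
  shows "ennreal (sqrt (\<Sum>k\<in>S. (cmod (fourier_coeff f k))\<^sup>2 * hybrid_weight \<alpha> \<beta> k))
    \<le> max (hybrid_norm \<alpha> \<beta> (\<lambda>x. f x - g x)) (hybrid_norm \<alpha> \<beta> (\<lambda>x. - f x - g x))"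
proof -
  define Q where "Q u = (\<Sum>k\<in>S. (cmod (fourier_coeff u k))\<^sup>2 * hybrid_weight \<alpha> \<beta> k)"
    for u :: "real ^ 'a \<Rightarrow> complex"
  have "(cmod (u - v))\<^sup>2 + (cmod (- u - v))\<^sup>2 = 2 * (cmod u)\<^sup>2 + 2 * (cmod v)\<^sup>2" for u v
    by (simp add: cmod_power2) (simp add: power2_eq_square algebra_simps)
  then have "Q (\<lambda>x. f x - g x) + Q (\<lambda>x. - f x - g x) = 2 * Q f + 2 * Q g"
    using assms
    by (simp add: Q_def fourier_coeff_diff fourier_coeff_uminus sum_distrib_left
        flip: sum.distrib distrib_right mult.assoc)
  moreover have "Q g \<ge> 0"
    by (auto simp: Q_def hybrid_weight_pos less_imp_le intro!: sum_nonneg)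
  ultimately have "Q f \<le> Q (\<lambda>x. f x - g x) \<or> Q f \<le> Q (\<lambda>x. - f x - g x)"
    by linarith
  then show ?thesis
    using sum_le_hybrid_norm [OF assms(4), of "\<lambda>x. f x - g x" \<alpha> \<beta>]
      sum_le_hybrid_norm [OF assms(4), of "\<lambda>x. - f x - g x" \<alpha> \<beta>]
    by (auto simp: Q_def le_max_iff_disj intro: order_trans [OF ennreal_leI] real_sqrt_le_mono)
qed

text \<open>Both f and - f lie in the unit ball and produce the zero sample vector, so
  \<open>A\<close> answers both with the same function and must be far from one of them.\<close>

lemma sum_le_Samp:
  assumes f: "f \<in> C_torus" "hybrid_norm \<alpha> \<beta> f \<le> 1"
    and zero: "\<And>j. f (lattice_point z M j) = 0" and S: "finite S"
  shows "ennreal (sqrt (\<Sum>k\<in>S. (cmod (fourier_coeff f k))\<^sup>2 * hybrid_weight a b k))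
    \<le> Samp z M (cap_C (H_hybrid \<alpha> \<beta>)) (H_hybrid a b)"
  unfolding Samp_def
proof (rule INF_greatest)
  fix A :: "(nat \<Rightarrow> complex) \<Rightarrow> real ^ 'a \<Rightarrow> complex"
  assume A: "A \<in> ({..<M} \<rightarrow>\<^sub>E UNIV) \<rightarrow> fst (H_hybrid a b)"
  let ?err = "\<lambda>u. hybrid_norm a b (\<lambda>x. u x - A (lattice_samples z M u) x)"
  let ?B = "{u \<in> fst (cap_C (H_hybrid \<alpha> \<beta>)). snd (cap_C (H_hybrid \<alpha> \<beta>)) u \<le> 1}"
  have ball: "u \<in> ?B" if "u \<in> C_torus" "hybrid_norm \<alpha> \<beta> u \<le> 1" for u
    using that ennreal_one_less_top by (auto simp: cap_C_def H_hybrid_def intro: le_less_trans)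
  have samples: "lattice_samples z M (\<lambda>x. - f x) = lattice_samples z M f"
    by (simp add: lattice_samples_def zero)
  \<comment> \<open>Membership in the target space makes the Fourier coefficients of the two errors
    split into differences.\<close>
  have "A (lattice_samples z M f) \<in> L2_torus"
    using A by (auto simp: Pi_iff lattice_samples_def H_hybrid_def)
  with f S have "ennreal (sqrt (\<Sum>k\<in>S. (cmod (fourier_coeff f k))\<^sup>2 * hybrid_weight a b k))
      \<le> max (?err f) (?err (\<lambda>x. - f x))"
    unfolding samples using C_torus_subset_L2_torus uminus_in_C_torus
    by (intro sum_le_max_hybrid_norm) auto
  also have "\<dots> \<le> (SUP u\<in>?B. ?err u)"
    using f by (intro max.boundedI SUP_upper ball) (auto simp: uminus_in_C_torus hybrid_norm_uminus)
  finally show "ennreal (sqrt (\<Sum>k\<in>S. (cmod (fourier_coeff f k))\<^sup>2 * hybrid_weight a b k))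
      \<le> (SUP u\<in>?B. snd (H_hybrid a b) (\<lambda>x. u x - A (lattice_samples z M u) x))"
    by (simp add: H_hybrid_def)
qed

section \<open>Small solutions of a linear congruence\<close>

text \<open>Pigeonhole: with N the integer part of the square root of M, the (N + 1)^2 > M pairs in
  \<open>A\<close> have only M possible residues, and the difference of two colliding pairs is the
  solution.\<close>

lemma thue_congruence:
  fixes y z :: int
  assumes "M \<ge> 1"
  obtains a b :: int where "(a, b) \<noteq> (0, 0)" "a\<^sup>2 \<le> int M" "b\<^sup>2 \<le> int M" "int M dvd a * y - b * z"
proof -
  define N where "N = int (floor_sqrt M)"
  define A where "A = {0..N} \<times> {0..N}"
  define \<phi> where "\<phi> = (\<lambda>(a, b). (a * y - b * z) mod int M)"
  have N: "N \<ge> 0" "N\<^sup>2 \<le> int M" "int M < (N + 1)\<^sup>2"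
    using floor_sqrt_power2_le [of M] Suc_floor_sqrt_power2_gt [of M]
    by (simp_all add: N_def flip: of_nat_power of_nat_Suc add.commute [of 1] of_nat_less_iff of_nat_le_iff)
  have "card (\<phi> ` A) \<le> card {0..<int M}"
    using assms by (intro card_mono) (auto simp: \<phi>_def)
  also have "\<dots> < card A"
    using N by (simp add: A_def card_cartesian_product power2_eq_square nat_less_iff flip: nat_mult_distrib)
  finally have "\<not> inj_on \<phi> A"
    by (rule pigeonhole)
  then obtain a b a' b' where ab: "(a, b) \<in> A" "(a', b') \<in> A" "(a, b) \<noteq> (a', b')" "\<phi> (a, b) = \<phi> (a', b')"
    unfolding inj_on_def by fast
  \<comment> \<open>Differences of numbers in [0, N] have absolute value at most N, and N^2 \<le>
    M.\<close>
  have small: "(u - v)\<^sup>2 \<le> int M" if "u \<in> {0..N}" "v \<in> {0..N}" for u v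
    using that N by (intro order_trans [OF _ N(2)] abs_le_square_iff [THEN iffD1]) auto
  show thesis
  proof
    show "(a - a', b - b') \<noteq> (0, 0)"
      using ab by auto
    show "(a - a')\<^sup>2 \<le> int M" "(b - b')\<^sup>2 \<le> int M"
      using ab small by (auto simp: A_def)
    show "int M dvd (a - a') * y - (b - b') * z"
      using ab(4) by (simp add: \<phi>_def mod_eq_dvd_iff algebra_simps)
  qed
qed

section \<open>The lower bound for lattice sampling\<close>

text \<open>The target smoothness (a, b) is kept general and enters the bound only through a + b;
  (0, \<gamma>) and (\<gamma>, 0) give the two spaces of the theorem.\<close>

lemma g_latt_hybrid_lower_bound:
  fixes \<alpha> \<beta> a b :: real
  assumes d: "CARD('d::finite) \<ge> 2" and \<delta>: "\<alpha> + \<beta> - (a + b) > 0" and M: "M \<ge> 1"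
  shows "ennreal ((2 * real M) powr (- (\<alpha> + \<beta> - (a + b)) / 2))
    \<le> g_latt M (cap_C (H_hybrid \<alpha> \<beta>) :: 'd fspace) (H_hybrid a b)"
  unfolding g_latt_def
proof (rule INF_greatest)
  fix z :: "int ^ 'd"
  define \<delta> where "\<delta> = \<alpha> + \<beta> - (a + b)"
  obtain s t :: 'd where "s \<noteq> t"
    using d card_le_Suc0_iff_eq [of "UNIV :: 'd set"] by auto
  \<comment> \<open>The congruence says that the frequencies m on axis s and n on axis t have the
    same inner product with z modulo M.\<close>
  obtain m n where mn: "(m, n) \<noteq> (0, 0)" "m\<^sup>2 \<le> int M" "n\<^sup>2 \<le> int M" "int M dvd m * z $ s - n * z $ t"
    using thue_congruence [OF M] .
  define h k :: "int ^ 'd" where "h = axis s m" and "k = axis t n"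
  \<comment> \<open>Multiples of different unit vectors coincide only if both are zero. One of m and
    n may vanish.\<close>
  have "h \<noteq> k"
    using mn(1) \<open>s \<noteq> t\<close> by (auto simp: h_def k_def axis_eq_axis)
  define W where "W = hybrid_weight \<alpha> \<beta> h + hybrid_weight \<alpha> \<beta> k"
  have "W > 0"
    by (simp add: W_def add_pos_pos hybrid_weight_pos)
  \<comment> \<open>This scaling gives f norm 1 in the source space: both nonzero coefficients have
    squared modulus 1 / W.\<close>
  define c where "c = complex_of_real (1 / sqrt W)"
  have c: "(cmod c)\<^sup>2 = 1 / W"
    using \<open>W > 0\<close> by (simp add: c_def norm_divide power_divide)
  define f where "f x = c * (torus_char h x - torus_char k x)" for x
  have char_L2: "torus_char l \<in> L2_torus" for l :: "int ^ 'd"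
    using C_torus_subset_L2_torus
    by (auto simp: C_torus_def periodic1_torus_char continuous_on_torus_char)
  have f_C: "f \<in> C_torus"
    using periodic1_torus_char [of h] periodic1_torus_char [of k]
    by (auto simp: C_torus_def periodic1_def f_def [abs_def] intro!: continuous_intros continuous_on_torus_char)
  have coeff: "(cmod (fourier_coeff f l))\<^sup>2 = (if l \<in> {h, k} then 1 / W else 0)" for l
    using \<open>h \<noteq> k\<close>
    by (auto simp: f_def [abs_def] fourier_coeff_cmult fourier_coeff_diff char_L2 fourier_coeff_torus_char c)
  have "(\<Sum>\<^sub>\<infinity>l. (cmod (fourier_coeff f l))\<^sup>2 * hybrid_weight \<alpha> \<beta> l)
      = (\<Sum>\<^sub>\<infinity>l\<in>{h, k}. (cmod (fourier_coeff f l))\<^sup>2 * hybrid_weight \<alpha> \<beta> l)"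
    by (rule infsum_cong_neutral) (auto simp: coeff)
  also have "\<dots> = 1"
    using \<open>h \<noteq> k\<close> \<open>W > 0\<close> by (simp add: coeff W_def flip: add_divide_distrib)
  finally have f_norm: "hybrid_norm \<alpha> \<beta> f \<le> 1"
    using f_C C_torus_subset_L2_torus
    by (auto simp: hybrid_norm_def coeff intro!: finite_nonzero_values_imp_summable_on
        intro: finite_subset [of _ "{h, k}"] split: if_splits)
  have f_zero: "f (lattice_point z M j) = 0" for j
  proof -
    have "(\<Sum>i\<in>UNIV. h $ i * z $ i) = m * z $ s" "(\<Sum>i\<in>UNIV. k $ i * z $ i) = n * z $ t"
      by (simp_all add: h_def k_def axis_def if_distrib [of "\<lambda>u. u * _"] cong: if_cong)
    with mn(4) show ?thesis
      by (simp add: f_def torus_char_eq_at_lattice_point [OF M])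
  qed
  \<comment> \<open>On an axis the target weight is \<open>?t powr - \<delta>\<close> times the
    source weight, and a negative power is smallest at the largest base, here 2 M.\<close>
  have weight: "(2 * real M) powr - \<delta> * hybrid_weight \<alpha> \<beta> (axis i q) \<le> hybrid_weight a b (axis i q)"
    if "q\<^sup>2 \<le> int M" for i :: 'd and q
  proof -
    let ?t = "1 + (real_of_int q)\<^sup>2"
    have "?t > 0" by (simp add: add_pos_nonneg)
    moreover have "?t \<le> 2 * real M"
      using that M of_int_le_iff [of "q\<^sup>2" "int M", where ?'a = real] by simp
    ultimately have "(2 * real M) powr - \<delta> * ?t powr (\<alpha> + \<beta>) \<le> ?t powr - \<delta> * ?t powr (\<alpha> + \<beta>)"
      using \<delta> by (intro mult_right_mono powr_mono2') (auto simp: \<delta>_def)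
    then show ?thesis
      by (simp add: hybrid_weight_axis \<delta>_def flip: powr_add)
  qed
  \<comment> \<open>Adding the two weight comparisons and dividing by W gives the squared target
    norm of f on the right; the square root then halves the exponent.\<close>
  have "(2 * real M) powr - \<delta> \<le> (hybrid_weight a b h + hybrid_weight a b k) / W"
    using weight [OF mn(2), of s] weight [OF mn(3), of t] \<open>W > 0\<close>
    by (simp add: pos_le_divide_eq h_def k_def W_def distrib_left)
  also have "\<dots> = (\<Sum>l\<in>{h, k}. (cmod (fourier_coeff f l))\<^sup>2 * hybrid_weight a b l)"
    using \<open>h \<noteq> k\<close> by (simp add: coeff add_divide_distrib)
  finally have "(2 * real M) powr (- \<delta> / 2)
      \<le> sqrt (\<Sum>l\<in>{h, k}. (cmod (fourier_coeff f l))\<^sup>2 * hybrid_weight a b l)"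
    by (intro real_le_rsqrt) (simp add: power2_eq_square flip: powr_add)
  then show "ennreal ((2 * real M) powr (- (\<alpha> + \<beta> - (a + b)) / 2))
      \<le> Samp z M (cap_C (H_hybrid \<alpha> \<beta>)) (H_hybrid a b)"
    unfolding \<delta>_def
    by (intro order_trans [OF ennreal_leI sum_le_Samp [OF f_C f_norm f_zero]]) auto
qed

theorem proposition3p3:
  fixes \<alpha> \<beta> \<gamma> :: real and M :: nat
  assumes "CARD('d::finite) \<ge> 2"
    and "\<alpha> > \<gamma> - \<beta>" and "\<gamma> - \<beta> \<ge> 0" and "\<alpha> + \<beta> > 0"
    and "M \<ge> 1"
  shows "g_latt M (cap_C (H_hybrid \<alpha> \<beta>) :: 'd fspace) (H_iso \<gamma>)
           \<ge> ennreal (2 powr (- (\<alpha> + \<beta> - \<gamma> + 1) / 2) * real M powr (- (\<alpha> + \<beta> - \<gamma>) / 2))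
       \<and> g_latt M (cap_C (H_hybrid \<alpha> \<beta>) :: 'd fspace) (H_mix \<gamma>)
           \<ge> ennreal (2 powr (- (\<alpha> + \<beta> - \<gamma> + 1) / 2) * real M powr (- (\<alpha> + \<beta> - \<gamma>) / 2))"
proof -
  \<comment> \<open>The stated constant is smaller than the one obtained above by a factor of
    2^(-1/2).\<close>
  have "2 powr (- (\<alpha> + \<beta> - \<gamma> + 1) / 2) * real M powr (- (\<alpha> + \<beta> - \<gamma>) / 2)
      \<le> 2 powr (- (\<alpha> + \<beta> - \<gamma>) / 2) * real M powr (- (\<alpha> + \<beta> - \<gamma>) / 2)"
    by (intro mult_right_mono powr_mono) auto
  also have "\<dots> = (2 * real M) powr (- (\<alpha> + \<beta> - \<gamma>) / 2)"
    by (simp add: powr_mult)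
  finally have le: "ennreal (2 powr (- (\<alpha> + \<beta> - \<gamma> + 1) / 2) * real M powr (- (\<alpha> + \<beta> - \<gamma>) / 2))
      \<le> ennreal ((2 * real M) powr (- (\<alpha> + \<beta> - \<gamma>) / 2))"
    by (rule ennreal_leI)
  have "ennreal (2 powr (- (\<alpha> + \<beta> - \<gamma> + 1) / 2) * real M powr (- (\<alpha> + \<beta> - \<gamma>) / 2))
      \<le> g_latt M (cap_C (H_hybrid \<alpha> \<beta>) :: 'd fspace) (H_hybrid a b)" if "a + b = \<gamma>" for a b
  proof (rule order_trans [OF le])
    show "ennreal ((2 * real M) powr (- (\<alpha> + \<beta> - \<gamma>) / 2))
        \<le> g_latt M (cap_C (H_hybrid \<alpha> \<beta>) :: 'd fspace) (H_hybrid a b)"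
      using assms(2) that
      by (intro g_latt_hybrid_lower_bound [OF assms(1) _ assms(5), of \<alpha> \<beta> a b, unfolded that]) simp
  qed
  then show ?thesis
    by (simp only: H_iso_def H_mix_def add_0_left add_0_right)
qed

end
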